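(* Let $\mathcal{H}=(V,H)$ be a simplicial complex. Then $J(H\cup\{V\}) = H^{\mathrm{up}}$; that is, a subset $X\subseteq V$ belongs to $H^{\mathrm{up}}$ if and only if $X$ is a transversal of the successive differences of some chain in the Moore family $H\cup\{V\}$. Equivalently, the boolean matrix $M(H\cup\{V\})$ is a boolean matrix representation of $\mathcal{H}^{\mathrm{up}}=(V,H^{\mathrm{up}})$.
   Context: A simplicial complex is a pair $(V,H)$ where $V$ is a finite nonempty set and $H\subseteq 2^V$ contains every singleton $\{v\}$ ($v\in V$) and is closed under taking subsets. Define $H^{\mathrm{up}} = H\cup\{I\cup\{p\} : I\in H,\ p\in V\setminus I\}$ and $\mathcal{H}^{\mathrm{up}}=(V,H^{\mathrm{up}})$. Since $H$ is closed under intersection, $H\cup\{V\}$ is a Moore family (contains $V$, closed under intersection). Given a chain $F_0\subset F_1\subset\cdots\subset F_k$ of subsets of $V$, a transversal of its successive differences is a set $\{x_1,\dots,x_k\}$ with $x_i\in F_i\setminus F_{i-1}$ for all $i$. For a Moore family $R\subseteq 2^V$, $J(R)$ denotes the set of all transversals of successive differences of chains in $R$. For such $R$, $M(R)$ is the $R\times V$ boolean matrix with entry $0$ at $(r,v)$ if $v\in r$ and $1$ otherwise; the simplicial complex represented by $M(R)$ is $(V,J(R))$. *)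

theory Defs
  imports Main
begin

definition simplicial_complex :: "'v set \<Rightarrow> 'v set set \<Rightarrow> bool" where
  "simplicial_complex V H \<longleftrightarrow>
     finite V \<and> V \<noteq> {} \<and> H \<subseteq> Pow V \<and> (\<forall>v\<in>V. {v} \<in> H) \<and>
     (\<forall>X\<in>H. \<forall>Y. Y \<subseteq> X \<longrightarrow> Y \<in> H)"

definition up :: "'v set \<Rightarrow> 'v set set \<Rightarrow> 'v set set" where
  "up V H = H \<union> {I \<union> {p} | I p. I \<in> H \<and> p \<in> V - I}"

definition moore_family :: "'v set \<Rightarrow> 'v set set \<Rightarrow> bool" where
  "moore_family V R \<longleftrightarrow> R \<subseteq> Pow V \<and> V \<in> R \<and> (\<forall>A\<in>R. \<forall>B\<in>R. A \<inter> B \<in> R)"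

text \<open>A chain \<open>F 0 \<subset> F 1 \<subset> \<dots> \<subset> F k\<close> is given by the function \<open>F\<close> together with its length \<open>k\<close>;
  the values of \<open>F\<close> beyond \<open>k\<close> are irrelevant. The case \<open>k = 0\<close> is allowed, and its only
  transversal is the empty set.\<close>

definition is_chain_in :: "'v set set \<Rightarrow> (nat \<Rightarrow> 'v set) \<Rightarrow> nat \<Rightarrow> bool" where
  "is_chain_in R F k \<longleftrightarrow> (\<forall>i\<le>k. F i \<in> R) \<and> (\<forall>i<k. F i \<subset> F (Suc i))"

definition is_transversal :: "(nat \<Rightarrow> 'v set) \<Rightarrow> nat \<Rightarrow> 'v set \<Rightarrow> bool" where
  "is_transversal F k X \<longleftrightarrow>
     (\<exists>x. (\<forall>i\<in>{1..k}. x i \<in> F i - F (i - 1)) \<and> X = x ` {1..k})"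

definition J :: "'v set set \<Rightarrow> 'v set set" where
  "J R = {X. \<exists>F k. is_chain_in R F k \<and> is_transversal F k X}"

text \<open>Boolean matrices are two-argument predicates, with \<open>True\<close> as the entry 1 and \<open>False\<close> as the
  entry 0. The row and column index sets are passed separately, so \<open>M(R)\<close> is the function
  \<open>moore_matrix\<close> with row set \<open>R\<close> and column set \<open>V\<close>.\<close>

definition moore_matrix :: "'v set \<Rightarrow> 'v \<Rightarrow> bool" where
  "moore_matrix r v = (if v \<in> r then False else True)"

definition lower_unitriangular :: "('r \<Rightarrow> 'v \<Rightarrow> bool) \<Rightarrow> 'r list \<Rightarrow> 'v list \<Rightarrow> bool" where
  "lower_unitriangular M rs xs \<longleftrightarrow>
     length rs = length xs \<and>
     (\<forall>i<length xs. M (rs ! i) (xs ! i) = True) \<and>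
     (\<forall>j<length xs. \<forall>i<j. M (rs ! i) (xs ! j) = False)"

text \<open>A column set \<open>X\<close> is independent if some square submatrix with column set \<open>X\<close> becomes lower
  unitriangular after permuting rows and columns (equivalently, is nonsingular over the
  superboolean semiring). The distinct lists \<open>rs\<close> and \<open>xs\<close> are the permuted rows and columns.\<close>

definition independent_columns :: "'r set \<Rightarrow> ('r \<Rightarrow> 'v \<Rightarrow> bool) \<Rightarrow> 'v set \<Rightarrow> bool" where
  "independent_columns R M X \<longleftrightarrow>
     (\<exists>rs xs. distinct rs \<and> set rs \<subseteq> R \<and> distinct xs \<and> set xs = X \<and>
              lower_unitriangular M rs xs)"

definition boolean_representation ::
  "'r set \<Rightarrow> 'v set \<Rightarrow> ('r \<Rightarrow> 'v \<Rightarrow> bool) \<Rightarrow> 'v set set \<Rightarrow> bool" where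
  "boolean_representation R V M K \<longleftrightarrow>
     simplicial_complex V K \<and> (\<forall>X. X \<subseteq> V \<longrightarrow> (X \<in> K \<longleftrightarrow> independent_columns R M X))"

lemma moore_family_insert:
  assumes "simplicial_complex V H"
  shows "moore_family V (H \<union> {V})"
  unfolding moore_family_def
proof (intro conjI ballI)
  have H: "H \<subseteq> Pow V" and sub: "\<And>X Y. X \<in> H \<Longrightarrow> Y \<subseteq> X \<Longrightarrow> Y \<in> H"
    using assms unfolding simplicial_complex_def by simp_all
  show "H \<union> {V} \<subseteq> Pow V" using H by simp
  show "V \<in> H \<union> {V}" by simp
  fix A B assume AB: "A \<in> H \<union> {V}" "B \<in> H \<union> {V}"
  show "A \<inter> B \<in> H \<union> {V}"
    using AB sub[of A "A \<inter> B"] sub[of B "A \<inter> B"] by auto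
qed

lemma moore_matrix_iff: "moore_matrix r v \<longleftrightarrow> v \<notin> r"
  by (simp add: moore_matrix_def)

lemma chain_mono:
  assumes "is_chain_in R F k" "i \<le> j" "j \<le> k"
  shows "F i \<subseteq> F j"
  using assms(2,3)
proof (induction j rule: dec_induct)
  case base
  then show ?case by simp
next
  case (step n)
  then have "F n \<subseteq> F (Suc n)" using assms(1) by (simp add: is_chain_in_def psubset_imp_subset)
  with step show ?case by simp
qed

lemma independent_columns_iff_J:
  assumes R: "moore_family V R" and X: "X \<subseteq> V"
  shows "independent_columns R moore_matrix X \<longleftrightarrow> X \<in> J R"
proof
  assume "independent_columns R moore_matrix X"
  then obtain rs xs where rs: "set rs \<subseteq> R" and xs: "set xs = X"
    and lu: "lower_unitriangular moore_matrix rs xs"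
    unfolding independent_columns_def by blast
  from lu have len: "length rs = length xs"
    and diag: "\<And>i. i < length xs \<Longrightarrow> xs ! i \<notin> rs ! i"
    and tri: "\<And>i j. j < length xs \<Longrightarrow> i < j \<Longrightarrow> xs ! j \<in> rs ! i"
    by (simp_all add: lower_unitriangular_def moore_matrix_iff)
  define k where "k = length xs"
  define G where "G i = V \<inter> (\<Inter>j<i. rs ! j)" for i
  define F where "F i = G (k - i)" for i
  define x where "x i = xs ! (k - i)" for i
  have GR: "G i \<in> R" if "i \<le> k" for i
    using that
  proof (induction i)
    case 0
    then show ?case using R by (simp add: G_def moore_family_def)
  next
    case (Suc i)
    have "G (Suc i) = G i \<inter> rs ! i" by (auto simp: G_def less_Suc_eq)
    moreover have "rs ! i \<in> R" using rs Suc.prems len k_def by (simp add: subset_iff)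
    ultimately show ?case using Suc R by (simp add: moore_family_def)
  qed
  have step: "xs ! i \<in> G i - G (Suc i)" if "i < k" for i
  proof -
    have "xs ! i \<in> V" using that X xs nth_mem[of i xs] unfolding k_def by blast
    moreover have "\<forall>j<i. xs ! i \<in> rs ! j" using that tri unfolding k_def by blast
    moreover have "xs ! i \<notin> rs ! i" using that diag unfolding k_def by blast
    ultimately show ?thesis unfolding G_def by blast
  qed
  have sub: "G (Suc i) \<subseteq> G i" for i by (auto simp: G_def)
  have "is_chain_in R F k"
    unfolding is_chain_in_def
  proof (intro conjI allI impI)
    fix i assume "i \<le> k"
    then show "F i \<in> R" by (simp add: F_def GR)
  next
    fix i assume "i < k"
    then have "k - i = Suc (k - Suc i)" "k - Suc i < k" by auto
    then show "F i \<subset> F (Suc i)"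
      using step[of "k - Suc i"] sub[of "k - Suc i"] by (auto simp: F_def)
  qed
  moreover have "is_transversal F k X"
    unfolding is_transversal_def
  proof (intro exI[of _ x] conjI ballI)
    fix i assume "i \<in> {1..k}"
    then have "k - (i - 1) = Suc (k - i)" "k - i < k" by auto
    then show "x i \<in> F i - F (i - 1)" using step[of "k - i"] by (simp add: F_def x_def)
  next
    have "(\<lambda>i. k - i) ` {1..k} = {..<k}"
    proof (intro equalityI subsetI)
      fix j assume "j \<in> {..<k}"
      then show "j \<in> (\<lambda>i. k - i) ` {1..k}" by (intro image_eqI[of _ _ "k - j"]) auto
    qed auto
    then have "x ` {1..k} = (\<lambda>i. xs ! i) ` {..<k}"
      unfolding x_def using image_image[of "\<lambda>i. xs ! i" "\<lambda>i. k - i" "{1..k}"] by simp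
    also have "\<dots> = X" unfolding xs[symmetric] k_def set_conv_nth by blast
    finally show "X = x ` {1..k}" by simp
  qed
  ultimately show "X \<in> J R" by (auto simp: J_def)
next
  assume "X \<in> J R"
  then obtain F k x where ch: "is_chain_in R F k"
    and tr: "\<forall>i\<in>{1..k}. x i \<in> F i - F (i - 1)" and Xx: "X = x ` {1..k}"
    unfolding J_def is_transversal_def by blast
  from tr have x: "\<And>i. 1 \<le> i \<Longrightarrow> i \<le> k \<Longrightarrow> x i \<in> F i - F (i - 1)"
    by simp
  define rs where "rs = map F (rev [0..<k])"
  define xs where "xs = map x (rev [1..<Suc k])"
  have ltF: "F i \<noteq> F j" if "i < j" "j \<le> k" for i j
  proof -
    have "F i \<subseteq> F (j - 1)" using that by (intro chain_mono[OF ch]) auto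
    moreover have "x j \<in> F j - F (j - 1)" using that by (intro x) auto
    ultimately show ?thesis by blast
  qed
  have ltx: "x i \<in> F j" if "1 \<le> i" "i \<le> j" "j \<le> k" for i j
    using chain_mono[OF ch, of i j] x[of i] that by auto
  have nex: "x i \<noteq> x j" if "1 \<le> i" "i < j" "j \<le> k" for i j
  proof -
    have "x i \<in> F (j - 1)" using that by (intro ltx) auto
    moreover have "x j \<in> F j - F (j - 1)" using that by (intro x) auto
    ultimately show ?thesis by auto
  qed
  have "inj_on F {0..<k}"
    by (intro linorder_inj_onI') (use ltF in simp)
  then have "distinct rs" by (simp add: rs_def distinct_map)
  moreover have "inj_on x {1..<Suc k}"
    by (intro linorder_inj_onI') (use nex in simp)
  then have "distinct xs" unfolding xs_def by (simp only: distinct_map distinct_rev set_rev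
      distinct_upt set_upt simp_thms)
  moreover have "set rs \<subseteq> R" using ch by (auto simp: rs_def is_chain_in_def)
  moreover have "set xs = X" unfolding xs_def Xx
    by (simp only: set_map set_rev set_upt atLeastLessThanSuc_atLeastAtMost)
  moreover have "lower_unitriangular moore_matrix rs xs"
  proof -
    have len: "length rs = k" "length xs = k" by (auto simp: rs_def xs_def)
    have rsn: "rs ! i = F (k - Suc i)" if "i < k" for i
      using that by (simp add: rs_def rev_nth)
    have xsn: "xs ! i = x (k - i)" if "i < k" for i
      using that by (simp add: xs_def rev_nth Suc_diff_Suc del: upt_Suc)
    show ?thesis
      unfolding lower_unitriangular_def len
    proof (intro conjI allI impI)
      show "k = k" ..
    next
      fix i assume i: "i < k"
      then have "x (k - i) \<notin> F (k - Suc i)" using x[of "k - i"] by simp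
      then show "moore_matrix (rs ! i) (xs ! i) = True"
        using i by (simp add: moore_matrix_def rsn xsn)
    next
      fix i j assume ij: "j < k" "i < j"
      then have "x (k - j) \<in> F (k - Suc i)" by (intro ltx) auto
      then show "moore_matrix (rs ! i) (xs ! j) = False"
        using ij by (simp add: moore_matrix_def rsn xsn)
    qed
  qed
  ultimately show "independent_columns R moore_matrix X"
    unfolding independent_columns_def by blast
qed

end

theory Submission
  imports Defs
begin

text \<open>If \<open>F\<^sub>0 \<subset> \<dots> \<subset> F\<^sub>k\<close> is a chain in \<open>H \<union> {V}\<close> with \<open>k \<ge> 1\<close>, then \<open>F\<^sub>k\<^sub>-\<^sub>1 \<noteq> V\<close> is a face, so all points of
  a transversal except the last one lie in a common face. Conversely, for a face \<open>I\<close> and a point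
  \<open>p \<notin> I\<close> the set \<open>I \<union> {p}\<close> is a transversal of a full flag of subsets of \<open>I\<close> followed by \<open>V\<close>.\<close>

text \<open>Adding the points of \<open>A\<close> one at a time gives a flag from the empty set to
  \<open>A\<close>, and a final jump to \<open>B\<close> picks up \<open>p\<close>. The top
  \<open>B\<close> stays general: below it is \<open>V\<close> for a new set
  \<open>I \<union> {p}\<close>, and the face itself when the set is already a face.\<close>

lemma insert_in_J:
  assumes "finite A" and sub: "\<And>Y. Y \<subseteq> A \<Longrightarrow> Y \<in> R"
    and B: "B \<in> R" "A \<subseteq> B" and p: "p \<in> B - A"
  shows "insert p A \<in> J R"
proof -
  obtain xs where xs: "set xs = A" "distinct xs"
    using finite_distinct_list[OF \<open>finite A\<close>] by blast
  define k where "k = length xs"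
  define F where "F i = (if i \<le> k then set (take i xs) else B)" for i
  define x where "x i = (if i \<le> k then xs ! (i - 1) else p)" for i
  have new: "x (Suc i) \<in> F (Suc i) - F i" if "i \<le> k" for i
  proof (cases "i = k")
    case True
    then show ?thesis using p xs by (simp add: F_def x_def k_def)
  next
    case False
    with that have "i < length xs" by (simp add: k_def)
    moreover from this have "xs ! i \<notin> set (take i xs)"
      using xs(2) by (auto simp: in_set_conv_nth nth_eq_iff_index_eq)
    ultimately show ?thesis by (simp add: F_def x_def k_def take_Suc_conv_app_nth)
  qed
  have mono: "F i \<subseteq> F (Suc i)" if "i \<le> k" for i
    using that B(2) xs(1) set_take_subset[of i xs] set_take_subset_set_take[of i "Suc i" xs]
    by (auto simp: F_def)
  have "F i \<in> R" for i
    using B(1) sub[of "set (take i xs)"] xs(1) set_take_subset[of i xs] by (simp add: F_def)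
  moreover have "F i \<subset> F (Suc i)" if "i < Suc k" for i
    using new[of i] mono[of i] that by auto
  ultimately have "is_chain_in R F (Suc k)" by (simp add: is_chain_in_def)
  moreover have "is_transversal F (Suc k) (insert p A)"
    unfolding is_transversal_def
  proof (intro exI[of _ x] conjI ballI)
    fix i assume "i \<in> {1..Suc k}"
    then show "x i \<in> F i - F (i - 1)" using new[of "i - 1"] by (cases i) auto
  next
    \<comment> \<open>Splitting off the last index isolates \<open>p\<close>; the shift by
      \<open>Suc\<close> turns the remaining values into \<open>xs ! i\<close> for
      \<open>i < k\<close>.\<close>
    have "{1..Suc k} = insert (Suc k) (Suc ` {..<k})"
      by (auto simp: image_Suc_lessThan)
    then have "x ` {1..Suc k} = insert (x (Suc k)) ((\<lambda>i. x (Suc i)) ` {..<k})"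
      by (simp only: image_insert image_image)
    also have "\<dots> = insert p ((!) xs ` {..<k})"
      by (simp add: x_def cong: image_cong_simp)
    also have "(!) xs ` {..<k} = A"
      using xs(1) by (auto simp: k_def set_conv_nth)
    finally show "insert p A = x ` {1..Suc k}" by simp
  qed
  ultimately show ?thesis by (auto simp: J_def)
qed

lemma empty_in_J:
  assumes "A \<in> R"
  shows "{} \<in> J R"
proof -
  have "is_chain_in R (\<lambda>_. A) 0" "is_transversal (\<lambda>_. A) 0 {}"
    using assms by (simp_all add: is_chain_in_def is_transversal_def)
  then show ?thesis unfolding J_def by blast
qed

lemma J_insert_eq_up:
  assumes "simplicial_complex V H"
  shows "J (H \<union> {V}) = up V H"
proof
  have V: "finite V" "V \<noteq> {}" and H: "H \<subseteq> Pow V" and single: "\<forall>v\<in>V. {v} \<in> H"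
    and sub: "\<And>X Y. X \<in> H \<Longrightarrow> Y \<subseteq> X \<Longrightarrow> Y \<in> H"
    using assms unfolding simplicial_complex_def by simp_all
  show "J (H \<union> {V}) \<subseteq> up V H"
  proof
    fix X assume "X \<in> J (H \<union> {V})"
    then obtain F k x where ch: "is_chain_in (H \<union> {V}) F k"
      and x: "\<And>i. i \<in> {1..k} \<Longrightarrow> x i \<in> F i - F (i - 1)" and X: "X = x ` {1..k}"
      unfolding J_def is_transversal_def by blast
    show "X \<in> up V H"
    proof (cases k)
      case 0
      \<comment> \<open>Here \<open>X\<close> is empty; it lies in \<open>H\<close> as a subset of
        some singleton, which exists because \<open>V\<close> is nonempty.\<close>
      then show ?thesis using X V(2) single sub[of _ "{}"] by (auto simp: up_def)
    next
      case (Suc m)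
      have "F k \<subseteq> V" "F m \<in> H \<union> {V}" "F m \<subset> F k"
        using ch H Suc by (auto simp: is_chain_in_def)
      then have "F m \<in> H" by auto
      moreover have I: "x ` {1..m} \<subseteq> F m"
      proof
        fix y assume "y \<in> x ` {1..m}"
        then obtain i where "1 \<le> i" "i \<le> m" "y = x i" by auto
        then show "y \<in> F m" using x[of i] chain_mono[OF ch, of i m] Suc by auto
      qed
      ultimately have "x ` {1..m} \<in> H" by (rule sub)
      \<comment> \<open>Since \<open>m = k - 1\<close>, the point \<open>x k\<close> avoids
        \<open>F m\<close>, which contains all earlier points.\<close>
      moreover have "x k \<in> V - x ` {1..m}"
        using x[of k] I \<open>F k \<subseteq> V\<close> Suc by auto
      moreover have "X = x ` {1..m} \<union> {x k}"
        by (simp add: X Suc atLeastAtMostSuc_conv)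
      ultimately show ?thesis unfolding up_def by blast
    qed
  qed
  have ins: "insert p I \<in> J (H \<union> {V})" if "I \<in> H" "B \<in> H \<union> {V}" "I \<subseteq> B" "p \<in> B - I" for p I B
  proof (rule insert_in_J[of I _ B])
    show "finite I" using that(1) H V(1) finite_subset by blast
  qed (use that sub in auto)
  show "up V H \<subseteq> J (H \<union> {V})"
  proof
    fix X assume "X \<in> up V H"
    \<comment> \<open>A nonempty face is treated as a smaller face plus one point; the empty set has
      no point to split off and comes from a chain of length 0.\<close>
    then consider (empty) "X = {}" | (face) p where "X \<in> H" "p \<in> X"
      | (new) I p where "I \<in> H" "p \<in> V - I" "X = insert p I"
      unfolding up_def by auto
    then show "X \<in> J (H \<union> {V})"
    proof cases
      case empty
      then show ?thesis using empty_in_J[of V] by simp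
    next
      case face
      then show ?thesis
        using ins[of "X - {p}" X p] sub[of X "X - {p}"] by (auto simp: insert_absorb)
    next
      case new
      then show ?thesis using ins[of I V p] H by auto
    qed
  qed
qed

text \<open>Only closure under subsets takes work: removing \<open>p\<close> from a subset of
  \<open>I \<union> {p}\<close> leaves a subset of \<open>I\<close>, hence a face.\<close>

lemma simplicial_complex_up:
  assumes "simplicial_complex V H"
  shows "simplicial_complex V (up V H)"
proof -
  have V: "finite V" "V \<noteq> {}" and H: "H \<subseteq> Pow V" and single: "\<forall>v\<in>V. {v} \<in> H"
    and sub: "\<And>X Y. X \<in> H \<Longrightarrow> Y \<subseteq> X \<Longrightarrow> Y \<in> H"
    using assms unfolding simplicial_complex_def by simp_all
  have "Y \<in> up V H" if "X \<in> up V H" "Y \<subseteq> X" for X Y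
  proof (cases "Y \<in> H")
    case True
    then show ?thesis by (simp add: up_def)
  next
    case False
    with that sub obtain I p where I: "I \<in> H" "p \<in> V - I" "X = I \<union> {p}"
      unfolding up_def by blast
    then have "Y - {p} \<in> H" using sub[of I "Y - {p}"] that(2) by blast
    \<comment> \<open>If \<open>p\<close> were not in \<open>Y\<close>, then
      \<open>Y = Y - {p}\<close> would be in \<open>H\<close>.\<close>
    moreover have "Y = (Y - {p}) \<union> {p}"
      using False calculation by (cases "p \<in> Y") auto
    ultimately show ?thesis using I(2) unfolding up_def by blast
  qed
  moreover have "up V H \<subseteq> Pow V" using H by (auto simp: up_def)
  ultimately show ?thesis
    using V single unfolding simplicial_complex_def by (auto simp: up_def)
qed

theorem theorem3p1:
  fixes V :: "'v set" and H :: "'v set set"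
  assumes "simplicial_complex V H"
  shows "J (H \<union> {V}) = up V H \<and>
         (\<forall>X. X \<subseteq> V \<longrightarrow>
            (X \<in> up V H \<longleftrightarrow> (\<exists>F k. is_chain_in (H \<union> {V}) F k \<and> is_transversal F k X))) \<and>
         boolean_representation (H \<union> {V}) V moore_matrix (up V H)"
proof (intro conjI)
  show J: "J (H \<union> {V}) = up V H" by (rule J_insert_eq_up[OF assms])
  show "\<forall>X. X \<subseteq> V \<longrightarrow>
      (X \<in> up V H \<longleftrightarrow> (\<exists>F k. is_chain_in (H \<union> {V}) F k \<and> is_transversal F k X))"
    unfolding J[symmetric] J_def by simp
  \<comment> \<open>For any Moore family, column independence in its matrix agrees with membership
    in \<open>J\<close>, so the equality \<open>J\<close> transfers to the matrix.\<close>
  show "boolean_representation (H \<union> {V}) V moore_matrix (up V H)"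
    unfolding boolean_representation_def
    using simplicial_complex_up[OF assms] J
      independent_columns_iff_J[OF moore_family_insert[OF assms]] by simp
qed

end
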